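(* Let $F$ be a friend of $10$ written as $F=5^{2a_1}\cdot\prod_{i=2}^{\omega(F)}p_i^{2a_i}$, where $p_1=5$, the $p_i$ for $2\le i\le \omega(F)$ are distinct prime numbers with $p_i>5$, and $a_1,\dots,a_{\omega(F)}$ are positive integers. Then not all $a_i$ ($1\le i\le\omega(F)$) are congruent to $1$ modulo $3$; that is, there exists $i\in\{1,\dots,\omega(F)\}$ with $a_i\not\equiv 1\pmod{3}$.
   Context: For a positive integer $n$, $\sigma(n)$ denotes the sum of the positive divisors of $n$, $I(n)=\sigma(n)/n$ is the abundancy index of $n$, and $\omega(n)$ is the number of distinct prime divisors of $n$. Two distinct positive integers are friends of each other if they have the same abundancy index. Thus a friend of $10$ is a positive integer $F\neq 10$ with $I(F)=I(10)=9/5$, i.e. $5\sigma(F)=9F$. *)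

theory Defs
  imports Complex_Main "HOL-Number_Theory.Number_Theory"
begin

definition divisor_sum :: "nat \<Rightarrow> nat" where
  "divisor_sum n = (\<Sum>d | d dvd n. d)"

definition abundancy :: "nat \<Rightarrow> rat" where
  "abundancy n = of_nat (divisor_sum n) / of_nat n"

definition omega :: "nat \<Rightarrow> nat" where
  "omega n = card (prime_factors n)"

definition friend_of :: "nat \<Rightarrow> nat \<Rightarrow> bool" where
  "friend_of m n \<longleftrightarrow> m > 0 \<and> n > 0 \<and> m \<noteq> n \<and> abundancy m = abundancy n"

end

theory Submission
  imports Defs
begin

text \<open>
  If all \<open>a\<^sub>i\<close> are \<open>1\<close> modulo \<open>3\<close>, every prime \<open>q\<close> dividing \<open>F\<close> has an exponent that is \<open>2\<close>
  modulo \<open>3\<close>, so \<open>1 + q + q\<^sup>2\<close> divides \<open>\<sigma>(F)\<close>, which divides \<open>9F\<close>. Starting from \<open>q = 5\<close>, the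
  factorizations \<open>1 + 5 + 5\<^sup>2 = 31\<close>, \<open>1 + 31 + 31\<^sup>2 = 3 \<cdot> 331\<close> and
  \<open>1 + 331 + 331\<^sup>2 = 3 \<cdot> 7 \<cdot> 5233\<close> force \<open>31\<close>, \<open>331\<close> and \<open>7\<close> to divide \<open>F\<close>. These three primes
  are \<open>1\<close> modulo \<open>3\<close>, so each contributes a factor \<open>3\<close> to \<open>\<sigma>(F)\<close>; hence \<open>27\<close> divides \<open>9F\<close>,
  although \<open>3\<close> does not divide \<open>F\<close>.
\<close>

text \<open>Multiplication maps pairs of divisors of \<open>m\<close> and \<open>n\<close>
  bijectively onto the divisors of \<open>m * n\<close>; coprimality gives injectivity.\<close>

lemma divisor_sum_mult_coprime:
  assumes "coprime m n" "m > 0" "n > 0"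
  shows "divisor_sum (m * n) = divisor_sum m * divisor_sum n"
proof -
  let ?D = "\<lambda>k::nat. {d. d dvd k}"
  have inj: "inj_on (\<lambda>(x, y). x * y) (?D m \<times> ?D n)"
  proof (rule inj_onI, clarify)
    fix x y x' y' assume d: "x dvd m" "y dvd n" "x' dvd m" "y' dvd n" and eq: "x * y = x' * y'"
    have c: "coprime x y'" "coprime x' y"
      using assms(1) d by (meson coprime_divisors)+
    have "x dvd x' * y'" "x' dvd x * y"
      using eq by (metis dvd_triv_left)+
    then have "x dvd x'" "x' dvd x"
      using c by (simp_all add: coprime_dvd_mult_left_iff)
    then have "x = x'" by (rule dvd_antisym)
    moreover have "x > 0" using d assms(2) by (auto intro: Nat.gr0I)
    ultimately show "x = x' \<and> y = y'" using eq by simp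
  qed
  have img: "(\<lambda>(x, y). x * y) ` (?D m \<times> ?D n) = ?D (m * n)"
    by (auto simp: image_iff intro: mult_dvd_mono elim!: dvd_productE)
  have "divisor_sum m * divisor_sum n = (\<Sum>(x, y)\<in>?D m \<times> ?D n. x * y)"
    unfolding divisor_sum_def by (simp add: sum_product sum.cartesian_product)
  also have "\<dots> = divisor_sum (m * n)"
    unfolding divisor_sum_def img[symmetric] by (subst sum.reindex[OF inj]) (simp add: case_prod_unfold)
  finally show ?thesis by simp
qed

lemma divisor_sum_prime_power:
  assumes "prime q"
  shows "divisor_sum (q ^ e) = (\<Sum>i\<le>e. q ^ i)"
proof -
  have "{d. d dvd q ^ e} = (\<lambda>i. q ^ i) ` {..e}"
    using divides_primepow_nat[OF assms] by auto
  moreover have "inj_on (\<lambda>i. q ^ i) {..e}"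
    using prime_gt_1_nat[OF assms] by (auto intro!: inj_onI simp: power_inject_exp)
  ultimately show ?thesis
    unfolding divisor_sum_def by (simp add: sum.reindex)
qed

text \<open>The \<open>3 * k + 3\<close> terms fall into consecutive blocks of three, each a power
  of \<open>q ^ 3\<close> times the trinomial.\<close>

lemma trinomial_dvd_geometric_sum:
  fixes q :: nat
  shows "1 + q + q ^ 2 dvd (\<Sum>i\<le>3 * k + 2. q ^ i)"
proof (induction k)
  case 0
  show ?case by (simp add: numeral_2_eq_2)
next
  case (Suc k)
  have "(\<Sum>i\<le>3 * Suc k + 2. q ^ i) = (\<Sum>i\<le>3 * k + 2. q ^ i) + q ^ (3 * k + 3) * (1 + q + q ^ 2)"
    by (simp add: eval_nat_numeral algebra_simps)
  with Suc show ?case by (simp only: dvd_add dvd_triv_right)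
qed

text \<open>Each induction step splits off the full power of one prime, which leaves the
  multiplicities of the other primes unchanged. Taking the product matters because the trinomials
  may share factors: this is how several factors \<open>3\<close> are counted together.\<close>

lemma prod_trinomial_dvd_divisor_sum:
  assumes "finite S" "n > 0" "\<And>q. q \<in> S \<Longrightarrow> prime q \<and> multiplicity q n mod 3 = 2"
  shows "(\<Prod>q\<in>S. 1 + q + q ^ 2) dvd divisor_sum n"
  using assms
proof (induction S arbitrary: n rule: finite_induct)
  case empty
  show ?case by simp
next
  case (insert q S)
  define e where "e = multiplicity q n"
  have q: "prime q" and e: "e mod 3 = 2"
    using insert.prems(2)[of q] by (auto simp: e_def)
  obtain m where m: "n = q ^ e * m" "\<not> q dvd m"
    unfolding e_def using multiplicity_decompose'[of n q] insert.prems(1) q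
    by (metis not_prime_unit not_gr_zero)
  have "m > 0" using m insert.prems(1) by auto
  have "coprime (q ^ e) m"
    using q m(2) by (simp add: prime_imp_coprime)
  then have split: "divisor_sum n = divisor_sum (q ^ e) * divisor_sum m"
    using m(1) \<open>m > 0\<close> q by (simp add: divisor_sum_mult_coprime prime_gt_0_nat)
  have "e = 3 * (e div 3) + 2"
    using e by presburger
  then have "1 + q + q ^ 2 dvd divisor_sum (q ^ e)"
    using trinomial_dvd_geometric_sum[of q "e div 3"] by (metis divisor_sum_prime_power[OF q])
  moreover have "(\<Prod>r\<in>S. 1 + r + r ^ 2) dvd divisor_sum m"
  proof (rule insert.IH[OF \<open>m > 0\<close>])
    fix r assume r: "r \<in> S"
    then have "prime r" "multiplicity r n mod 3 = 2" "r \<noteq> q"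
      using insert by auto
    moreover have "multiplicity r n = multiplicity r m"
      using \<open>m > 0\<close> q \<open>prime r\<close> \<open>r \<noteq> q\<close> unfolding m(1)
      by (subst prime_elem_multiplicity_mult_distrib)
        (auto simp: multiplicity_distinct_prime_power)
    ultimately show "prime r \<and> multiplicity r m mod 3 = 2" by simp
  qed
  ultimately show ?case
    unfolding split prod.insert[OF insert.hyps] by (rule mult_dvd_mono)
qed

text \<open>Injectivity of \<open>p\<close> allows the product to be reindexed by the primes
  themselves, with \<open>inv_into I p\<close> recovering the index.\<close>

lemma multiplicity_prod_prime_powers_indexed:
  fixes p f :: "'a \<Rightarrow> nat"
  assumes "finite I" "inj_on p I" "\<And>i. i \<in> I \<Longrightarrow> prime (p i)" "j \<in> I"
  shows "multiplicity (p j) (\<Prod>i\<in>I. p i ^ f i) = f j"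
proof -
  have "(\<Prod>i\<in>I. p i ^ f i) = (\<Prod>q\<in>p ` I. q ^ f (inv_into I p q))"
    using assms by (simp add: prod.reindex)
  also have "multiplicity (p j) \<dots> = f (inv_into I p (p j))"
    using assms by (subst multiplicity_prod_prime_powers) auto
  finally show ?thesis
    using assms by simp
qed

lemma friend_of_10D:
  assumes "friend_of F 10"
  shows "5 * divisor_sum F = 9 * F" "F > 0"
proof -
  show "F > 0" using assms by (simp add: friend_of_def)
  have "divisor_sum (2 * 5) = 18"
    using divisor_sum_prime_power[of 2 1] divisor_sum_prime_power[of 5 1]
    by (subst divisor_sum_mult_coprime) simp_all
  then have "divisor_sum 10 = 18" by simp
  then have "(of_nat (divisor_sum F) :: rat) / of_nat F = 18 / 10"
    using assms by (simp add: friend_of_def abundancy_def)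
  then have "of_nat (5 * divisor_sum F) = (of_nat (9 * F) :: rat)"
    using \<open>F > 0\<close> by (simp add: field_simps)
  then show "5 * divisor_sum F = 9 * F" by (simp only: of_nat_eq_iff)
qed

text \<open>The arithmetic core, stated without reference to an indexed factorization.\<close>

lemma friend_of_10_exponents_mod_3:
  assumes F: "friend_of F 10" and "5 dvd F" "\<not> 3 dvd F"
  shows "\<exists>q. prime q \<and> q dvd F \<and> multiplicity q F mod 3 \<noteq> 2"
proof (rule ccontr)
  assume "\<not> ?thesis"
  then have mult: "multiplicity q F mod 3 = 2" if "prime q" "q dvd F" for q
    using that by blast
  note eq = friend_of_10D(1)[OF F] and pos = friend_of_10D(2)[OF F]
  have sigma: "divisor_sum F dvd 9 * F"
    unfolding eq[symmetric] by simp
  have step: "r dvd F" if "prime q" "q dvd F" "r dvd 1 + q + q ^ 2" "coprime r 9" for q r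
  proof -
    have "1 + q + q ^ 2 dvd divisor_sum F"
      using prod_trinomial_dvd_divisor_sum[of "{q}" F] mult that pos by simp
    then have "r dvd 9 * F" using that(3) sigma by (meson dvd_trans)
    then show ?thesis using that(4) by (simp add: coprime_dvd_mult_right_iff)
  qed
  have primes: "prime (5::nat)" "prime (31::nat)" "prime (331::nat)" "prime (7::nat)"
    by simp_all
  have cop: "coprime r 9" if "prime r" "r \<noteq> 3" for r :: nat
    using primes_coprime[OF that(1), of 3] that coprime_power_right_iff[of r 3 2] by simp
  have "31 dvd F" by (rule step[OF primes(1) \<open>5 dvd F\<close>]) (simp_all add: cop)
  then have "331 dvd F" by (rule step[OF primes(2)]) (simp_all add: cop)
  then have "7 dvd F" by (rule step[OF primes(3)]) (simp_all add: cop)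
  have S: "prime q \<and> multiplicity q F mod 3 = 2" if "q \<in> {7, 31, 331}" for q
    using that mult primes \<open>7 dvd F\<close> \<open>31 dvd F\<close> \<open>331 dvd F\<close> by blast
  have "(\<Prod>q\<in>{7, 31, 331::nat}. 1 + q + q ^ 2) dvd divisor_sum F"
    by (rule prod_trinomial_dvd_divisor_sum[OF _ pos S]) simp
  moreover have "27 dvd (\<Prod>q\<in>{7, 31, 331::nat}. 1 + q + q ^ 2)" by simp
  ultimately have "27 dvd 9 * F" using sigma by (meson dvd_trans)
  then have "3 dvd F" by presburger
  then show False using \<open>\<not> 3 dvd F\<close> by contradiction
qed

theorem theorem1p2:
  fixes F :: nat and p a :: "nat \<Rightarrow> nat"
  assumes "friend_of F 10"
    and "p 1 = 5"
    and "inj_on p {2..omega F}"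
    and "\<forall>i\<in>{2..omega F}. prime (p i) \<and> p i > 5"
    and "\<forall>i\<in>{1..omega F}. a i > 0"
    and "F = 5 ^ (2 * a 1) * (\<Prod>i=2..omega F. p i ^ (2 * a i))"
  shows "\<exists>i\<in>{1..omega F}. \<not> [a i = 1] (mod 3)"
proof (rule ccontr)
  assume "\<not> ?thesis"
  then have a: "a i mod 3 = 1" if "i \<in> {1..omega F}" for i
    using that by (auto simp: cong_def)
  \<comment> \<open>This makes \<open>omega F\<close> positive, so that \<open>1\<close> really is
    an index in \<open>{1..omega F}\<close> and positivity of \<open>a 1\<close> is
    available.\<close>
  have "F \<noteq> 1"
    using friend_of_10D(1)[OF assms(1)] by (auto simp: divisor_sum_def)
  then have "prime_factors F \<noteq> {}"
    using friend_of_10D(2)[OF assms(1)] by (auto simp: prime_factorization_empty_iff)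
  then have "omega F \<ge> 1"
    by (simp add: omega_def Suc_le_eq card_gt_0_iff)
  then have I: "{1..omega F} = insert 1 {2..omega F}" by auto
  have F: "F = (\<Prod>i\<in>{1..omega F}. p i ^ (2 * a i))"
    unfolding I using assms(2,6) by simp
  have pr: "prime (p i)" "p i \<ge> 5" if "i \<in> {1..omega F}" for i
    using that assms(2,4) unfolding I by (auto simp: less_imp_le)
  \<comment> \<open>Index 1 causes no collision, because all other \<open>p i\<close> exceed
    \<open>5 = p 1\<close>.\<close>
  have inj: "inj_on p {1..omega F}"
    unfolding I using assms(2-4) by (fastforce simp: inj_on_insert)
  have ex: "\<exists>i\<in>{1..omega F}. q = p i" if "prime q" "q dvd F" for q
  proof -
    from that obtain i where i: "i \<in> {1..omega F}" "q dvd p i ^ (2 * a i)"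
      by (subst (asm) (2) F) (auto simp: prime_dvd_prod_iff)
    then have "q dvd p i" using that(1) prime_dvd_power by blast
    then show ?thesis using i(1) that(1) pr(1) primes_dvd_imp_eq by blast
  qed
  have "a 1 > 0" using assms(5) \<open>omega F \<ge> 1\<close> by simp
  then have "5 dvd F"
    by (subst assms(6)) (auto intro!: dvd_mult2 dvd_power)
  \<comment> \<open>Otherwise 3 would be some \<open>p i\<close>, but these are all at least
    5.\<close>
  moreover have "\<not> 3 dvd F"
    using ex[of 3] pr(2) by fastforce
  ultimately obtain q where q: "prime q" "q dvd F" "multiplicity q F mod 3 \<noteq> 2"
    using friend_of_10_exponents_mod_3[OF assms(1)] by blast
  from ex[OF q(1,2)] obtain i where i: "i \<in> {1..omega F}" "q = p i" by blast
  have "multiplicity q F = 2 * a i"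
    unfolding i(2) by (subst F, rule multiplicity_prod_prime_powers_indexed)
      (use inj pr(1) i(1) in auto)
  moreover have "2 * a i mod 3 = 2"
    using a[OF i(1)] by presburger
  ultimately show False using q(3) by simp
qed

end
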